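(* Let $r\ge1$ and $n>r$ be integers, let $E_j=[\alpha_j,\beta_j]\subseteq[0,2\pi)$, $j=1,\dots,r$, be pairwise disjoint intervals of equal length $\Delta=\beta_j-\alpha_j>0$. Consider the multi-index $\vec n=(n-r,1,\dots,1)\in\mathbb N^{r+1}$ and the weights on the unit circle $\omega^{(1)}(e^{i\theta})=1$, $\omega^{(j+1)}(e^{i\theta})=\mathbf 1_{E_j}(\theta)$, $j=1,\dots,r$, and assume that the type I vector for $\vec n$ exists and is unique. Then the type I linear form is $$\Psi_{\vec n}(z)=\sum_{j=1}^rc_j\mathbf 1_{E_j}(\arg z)-\sum_{l=0}^{n-r-1}\left(\sum_{k=1}^r\frac{c_k\,a_l}{x_k^l}\right)z^l,$$ where $$c_j=\frac{(-1)^{r-1}x_j^{n-2}}{a_{n-1}}\,\frac{\prod_{m=1}^rx_m}{\prod_{m=1,\,m\ne j}^r(x_j-x_m)}.$$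
   Context: Type I linear form: for weights $\omega^{(1)},\dots,\omega^{(r+1)}$ on $\mathbb T=\{|z|=1\}$ and multi-index $\vec n=(n_1,\dots,n_{r+1})$ with $n=\sum_jn_j$, the type I vector is a nonzero vector of polynomials $(\Lambda_1,\dots,\Lambda_{r+1})$ with $\deg\Lambda_j\le n_j-1$ such that $\Psi_{\vec n}(z)=\sum_j\Lambda_j(z)\omega^{(j)}(z)$ satisfies $\int_{\mathbb T}\Psi_{\vec n}(z)\overline{z^k}\frac{|dz|}{2\pi}=0$ for $k=0,\dots,n-2$ and $=1$ for $k=n-1$. Notation: $\arg z\in[0,2\pi)$ for $z\in\mathbb T$; $\theta_j=\frac{\alpha_j+\beta_j}2$, $x_j=e^{i\theta_j}$; $a_\ell=\frac1{\ell\pi}\sin\left(\frac{\ell\Delta}2\right)$ for $\ell\ne0$ and $a_0=\frac{\Delta}{2\pi}$. *)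

theory Defs
  imports "HOL-Analysis.Analysis" "HOL-Computational_Algebra.Polynomial"
begin

definition circle_mean :: "(complex \<Rightarrow> complex) \<Rightarrow> complex" where
  "circle_mean f = (LINT \<theta>:{0..<2*pi}|lborel. f (cis \<theta>)) / of_real (2 * pi)"

definition type_I_form ::
    "nat \<Rightarrow> (nat \<Rightarrow> complex \<Rightarrow> real) \<Rightarrow> (nat \<Rightarrow> complex poly) \<Rightarrow> complex \<Rightarrow> complex" where
  "type_I_form s \<omega> \<Lambda> z = (\<Sum>j=1..s. poly (\<Lambda> j) z * of_real (\<omega> j z))"

text \<open>
  Vectors of \<open>s\<close> polynomials are functions indexed by \<open>{1..s}\<close>; extensionality fixes their irrelevant
  values outside \<open>{1..s}\<close>, so that uniqueness of a vector is equality of functions.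
  The bound \<open>deg \<le> N j - 1\<close> is written so that \<open>N j = 0\<close> forces the zero polynomial.
  The weights are meant to be integrable on the circle.
\<close>

definition type_I_vector ::
    "nat \<Rightarrow> (nat \<Rightarrow> complex \<Rightarrow> real) \<Rightarrow> (nat \<Rightarrow> nat) \<Rightarrow> (nat \<Rightarrow> complex poly) \<Rightarrow> bool" where
  "type_I_vector s \<omega> N \<Lambda> \<longleftrightarrow>
     \<Lambda> \<in> extensional {1..s} \<and>
     (\<exists>j\<in>{1..s}. \<Lambda> j \<noteq> 0) \<and>
     (\<forall>j\<in>{1..s}. \<Lambda> j = 0 \<or> degree (\<Lambda> j) < N j) \<and>
     (let n = (\<Sum>j=1..s. N j) in
        (\<forall>k. k + 1 < n \<longrightarrow> circle_mean (\<lambda>z. type_I_form s \<omega> \<Lambda> z * cnj (z ^ k)) = 0) \<and>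
        circle_mean (\<lambda>z. type_I_form s \<omega> \<Lambda> z * cnj (z ^ (n - 1))) = 1)"

text \<open>The library's \<^const>\<open>Arg2pi\<close> takes values in \<open>[0, 2\<pi>)\<close>.\<close>

definition arc_weights :: "(nat \<Rightarrow> real) \<Rightarrow> (nat \<Rightarrow> real) \<Rightarrow> nat \<Rightarrow> complex \<Rightarrow> real" where
  "arc_weights \<alpha> \<beta> j z = (if j = 1 then 1 else indicator {\<alpha> (j - 1)..\<beta> (j - 1)} (Arg2pi z))"

definition arc_index :: "nat \<Rightarrow> nat \<Rightarrow> nat \<Rightarrow> nat" where
  "arc_index n r j = (if j = 1 then n - r else 1)"

definition arc_mid :: "(nat \<Rightarrow> real) \<Rightarrow> (nat \<Rightarrow> real) \<Rightarrow> nat \<Rightarrow> complex" where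
  "arc_mid \<alpha> \<beta> j = cis ((\<alpha> j + \<beta> j) / 2)"

text \<open>The Fourier coefficients of the indicator of an arc of length \<open>\<Delta>\<close> centred at \<open>1\<close>.\<close>

definition arc_fourier :: "real \<Rightarrow> int \<Rightarrow> real" where
  "arc_fourier \<Delta> l =
     (if l = 0 then \<Delta> / (2 * pi) else 1 / (of_int l * pi) * sin (of_int l * \<Delta> / 2))"

end

(* The k-th moment of p + sum_j b_j 1_(E_j) is coeff p k + a_k sum_j b_j / x_j^k.  Since the type I
   vector is unique, it is enough that the claimed coefficients satisfy the moment conditions.
   For k < n - r this is the choice of p.  For k = n - 1 - e with e < r it is Lagrange interpolation
   of y^e at the nodes x_j, evaluated at y = 0.  The division by a_(n-1) is legitimate because the
   polynomial part does not reach degree n - 1, so that the normalisation of any type I vector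
   already forces a_(n-1) to be nonzero. *)

theory Submission
  imports Defs
begin

text \<open>The sum is the value at 0 of the Lagrange interpolant of y^e at the nodes x_j. Since e
  is below the number of nodes, the interpolant is the monomial itself. The convention 0^0 = 1
  covers e = 0.\<close>

lemma Lagrange_interpolation_power_at_0:
  fixes x :: "nat \<Rightarrow> 'a::field"
  assumes fin: "finite A" and inj: "inj_on x A" and e: "e < card A"
  shows "(\<Sum>j\<in>A. x j ^ e * (\<Prod>m\<in>A - {j}. - x m / (x j - x m))) = 0 ^ e"
proof -
  define L where "L j = (\<Prod>m\<in>A - {j}. smult (1 / (x j - x m)) [:- x m, 1:])" for j
  define P where "P = (\<Sum>j\<in>A. smult (x j ^ e) (L j))"
  have poly_L: "poly (L j) y = (\<Prod>m\<in>A - {j}. (y - x m) / (x j - x m))" for j y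
    unfolding L_def poly_prod by (intro prod.cong) (auto simp: diff_divide_distrib)
  have deg_L: "degree (L j) \<le> card A - 1" if "j \<in> A" for j
  proof -
    have "degree (L j) \<le> (\<Sum>m\<in>A - {j}. degree (smult (1 / (x j - x m)) [:- x m, 1:]))"
      unfolding L_def using fin by (intro degree_prod_sum_le[unfolded comp_def]) auto
    also have "\<dots> \<le> (\<Sum>m\<in>A - {j}. 1)"
      by (intro sum_mono) (auto intro: order.trans[OF degree_smult_le])
    finally show ?thesis
      using that fin by simp
  qed
  have node: "poly (L j) (x i) = (if i = j then 1 else 0)" if "i \<in> A" "j \<in> A" for i j
  proof (cases "i = j")
    case True
    have "(x j - x m) / (x j - x m) = 1" if "m \<in> A - {j}" for m
      using that inj \<open>j \<in> A\<close> by (auto simp: inj_on_def)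
    with True show ?thesis
      by (simp add: poly_L)
  next
    case False
    with that fin show ?thesis
      by (auto simp: poly_L intro!: prod_zero)
  qed
  have "P = monom 1 e"
  proof (rule poly_eqI_degree[where A = "x ` A"])
    fix y assume "y \<in> x ` A"
    then obtain i where i: "i \<in> A" "y = x i"
      by blast
    have "poly P y = (\<Sum>j\<in>A. if i = j then x j ^ e else 0)"
      unfolding P_def poly_sum using i by (intro sum.cong) (auto simp: node)
    then show "poly P y = poly (monom 1 e) y"
      using i fin by (simp add: poly_monom)
  next
    have "degree P \<le> card A - 1"
      unfolding P_def using fin deg_L
      by (intro degree_sum_le) (auto intro: order.trans[OF degree_smult_le])
    \<comment> \<open>\<open>e < card A\<close> makes \<open>A\<close> nonempty, so the truncated
      \<open>card A - 1\<close> really lies below \<open>card A\<close>.\<close>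
    then show "degree P < card (x ` A)"
      using e inj by (simp add: card_image)
    show "degree (monom (1::'a) e) < card (x ` A)"
      using e inj by (simp add: card_image degree_monom_eq)
  qed
  then have "poly P 0 = 0 ^ e"
    by (simp add: poly_monom)
  then show ?thesis
    by (simp add: P_def poly_sum poly_L)
qed

section \<open>Fourier integrals over arcs and over the full circle\<close>

lemma set_integrable_cis:
  fixes t a b :: real
  shows "set_integrable lborel {a..b} (\<lambda>\<theta>. cis (t * \<theta>))"
  by (intro borel_integrable_atLeastAtMost' continuous_intros)

text \<open>Rotating the arc so that it is centred at 1 splits off the phase of its midpoint and
  leaves a real coefficient. The factor 2 pi appears because \<open>arc_fourier\<close> is
  normalised by the length of the circle.\<close>

lemma set_integral_cis:
  fixes l :: int and a b :: real
  assumes "a \<le> b"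
  shows "(LINT \<theta>:{a..b}|lborel. cis (l * \<theta>))
    = of_real (2 * pi * arc_fourier (b - a) l) * cis (l * ((a + b) / 2))"
proof -
  have "((\<lambda>\<theta>. cis (l * \<theta>)) has_integral
    of_real (2 * pi * arc_fourier (b - a) l) * cis (l * ((a + b) / 2))) {a..b}"
  proof (cases "l = 0")
    case True
    then show ?thesis
      using has_integral_const_real[of "1::complex" a b] assms
      by (simp add: arc_fourier_def scaleR_conv_of_real)
  next
    case False
    have "((\<lambda>\<theta>. cis (l * \<theta>)) has_integral
       cis (l * b) / (\<i> * l) - cis (l * a) / (\<i> * l)) {a..b}"
    proof (rule fundamental_theorem_of_calculus[OF assms])
      fix \<theta> :: real
      \<comment> \<open>The antiderivative is differentiated as a holomorphic function and then
        restricted to the real line.\<close>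
      have "((\<lambda>z. exp (w * z) / w) has_field_derivative exp (w * \<theta>)) (at (of_real \<theta>))"
        if "w \<noteq> 0" for w :: complex
        using that by (auto intro!: derivative_eq_intros)
      from has_vector_derivative_real_field[OF this[of "\<i> * l"], of "{a..b}"] False
      show "((\<lambda>\<theta>. cis (l * \<theta>) / (\<i> * l)) has_vector_derivative cis (l * \<theta>)) (at \<theta> within {a..b})"
        by (simp only: cis_conv_exp of_real_mult of_real_of_int_eq mult.assoc) simp
    qed
    moreover have "cis (l * b) / (\<i> * l) - cis (l * a) / (\<i> * l)
      = of_real (2 * pi * arc_fourier (b - a) l) * cis (l * ((a + b) / 2))"
    proof -
      let ?u = "l * ((a + b) / 2)" and ?v = "l * (b - a) / 2"
      \<comment> \<open>Writing the endpoints as midpoint plus or minus half the length turns the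
        difference of exponentials into 2i times a sine.\<close>
      have ends: "l * b = ?u + ?v" "l * a = ?u - ?v"
        by (simp_all add: field_simps)
      have "cis (u + v) - cis (u - v) = cis u * (cis v - cis (- v))" for u v
        by (simp add: right_diff_distrib cis_mult)
      then have "cis (l * b) - cis (l * a) = cis ?u * (cis ?v - cis (- ?v))"
        unfolding ends by this
      also have "cis ?v - cis (- ?v) = 2 * \<i> * of_real (sin ?v)"
        by (simp add: complex_eq_iff)
      finally have "cis (l * b) / (\<i> * l) - cis (l * a) / (\<i> * l) = cis ?u * (2 * \<i> * of_real (sin ?v)) / (\<i> * l)"
        by (simp only: diff_divide_distrib [symmetric])
      also have "\<dots> = of_real (2 * sin ?v / l) * cis ?u"
        by simp
      also have "2 * sin ?v / l = 2 * pi * arc_fourier (b - a) l"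
        using False by (simp add: arc_fourier_def)
      finally show ?thesis .
    qed
    ultimately show ?thesis
      by simp
  qed
  then show ?thesis
    using set_borel_integral_eq_integral(2)[OF set_integrable_cis[of a b l]]
    by (simp add: integral_unique)
qed

text \<open>The conjugate of z^k produces the frequency -k, whereas the moments are to be expressed
  by a_k.\<close>

lemma arc_fourier_minus: "arc_fourier \<Delta> (- l) = arc_fourier \<Delta> l"
  by (simp add: arc_fourier_def)

text \<open>Up to the null set {2 pi} the circle is an arc of length 2 pi, and there the arc formula
  contains sin(l pi) = 0 for l nonzero.\<close>

lemma set_integral_cis_circle:
  fixes l :: int
  shows "set_integrable lborel {0..<2 * pi} (\<lambda>\<theta>. cis (l * \<theta>))"
    and "(LINT \<theta>:{0..<2 * pi}|lborel. cis (l * \<theta>)) = (if l = 0 then of_real (2 * pi) else 0)"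
proof -
  show "set_integrable lborel {0..<2 * pi} (\<lambda>\<theta>. cis (l * \<theta>))"
    by (rule set_integrable_subset[OF set_integrable_cis[of 0 "2 * pi"]]) auto
  have meas: "(\<lambda>\<theta>. cis (l * \<theta>)) \<in> borel_measurable lborel"
    by (auto intro!: borel_measurable_continuous_onI continuous_intros)
  have "(LINT \<theta>:{0..<2 * pi}|lborel. cis (l * \<theta>)) = (LINT \<theta>:{0..2 * pi}|lborel. cis (l * \<theta>))"
    unfolding set_lebesgue_integral_def
  proof (rule integral_cong_AE)
    show "AE \<theta> in lborel. indicator {0..<2 * pi} \<theta> *\<^sub>R cis (l * \<theta>)
        = indicator {0..2 * pi} \<theta> *\<^sub>R cis (l * \<theta>)"
      using AE_lborel_singleton[of "2 * pi"] by eventually_elim (auto simp: indicator_def)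
  qed (use meas in measurable)
  also have "\<dots> = (if l = 0 then of_real (2 * pi) else 0)"
    by (auto simp: set_integral_cis arc_fourier_def sin_zero_iff_int2)
  finally show "(LINT \<theta>:{0..<2 * pi}|lborel. cis (l * \<theta>))
    = (if l = 0 then of_real (2 * pi) else 0)" .
qed

section \<open>Moments of forms that are constant on each arc\<close>

lemma Arg2pi_cis: "0 \<le> \<theta> \<Longrightarrow> \<theta> < 2 * pi \<Longrightarrow> Arg2pi (cis \<theta>) = \<theta>"
  by (rule Arg2pi_unique[of 1]) (auto simp: cis_conv_exp)

lemma sum_Suc_shift: "(\<Sum>j=1..r + 1. f j) = f 1 + (\<Sum>j=1..r. f (Suc j))"
  for f :: "nat \<Rightarrow> 'a::comm_monoid_add"
  using sum.atLeast_Suc_atMost[of 1 "r + 1" f] sum.shift_bounds_cl_Suc_ivl[of f 1 r] by simp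

text \<open>Entries 1 of the multi-index force constant polynomials, so the type I vectors in
  question have this shape. The constants are indexed by arcs, hence the shift by one.\<close>

lemma type_I_form_arc_weights:
  assumes "\<forall>j\<in>{1..r}. \<Lambda> (Suc j) = [:b j:]"
  shows "type_I_form (r + 1) (arc_weights \<alpha> \<beta>) \<Lambda> z
    = poly (\<Lambda> 1) z + (\<Sum>j=1..r. b j * indicator {\<alpha> j..\<beta> j} (Arg2pi z))"
proof -
  have "(\<Sum>j=1..r. poly (\<Lambda> (Suc j)) z * of_real (arc_weights \<alpha> \<beta> (Suc j) z))
    = (\<Sum>j=1..r. b j * indicator {\<alpha> j..\<beta> j} (Arg2pi z))"
    using assms by (intro sum.cong) (auto simp: arc_weights_def indicator_def)
  then show ?thesis
    by (simp only: type_I_form_def sum_Suc_shift) (simp add: arc_weights_def)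
qed

text \<open>Orthogonality of the monomials extracts the coefficient of z^k from the polynomial part.
  Each arc contributes its Fourier coefficient, with the phase of the midpoint conjugated, which is
  inversion on the circle.\<close>

lemma circle_mean_type_I_form_arc_weights:
  assumes b: "\<forall>j\<in>{1..r}. \<Lambda> (Suc j) = [:b j:]"
    and sub: "\<forall>j\<in>{1..r}. {\<alpha> j..\<beta> j} \<subseteq> {0..<2 * pi}"
    and len: "\<forall>j\<in>{1..r}. \<beta> j - \<alpha> j = \<Delta>" and "0 < \<Delta>"
  shows "circle_mean (\<lambda>z. type_I_form (r + 1) (arc_weights \<alpha> \<beta>) \<Lambda> z * cnj (z ^ k))
    = coeff (\<Lambda> 1) k + (\<Sum>j=1..r. b j * of_real (arc_fourier \<Delta> (int k)) / arc_mid \<alpha> \<beta> j ^ k)"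
proof -
  let ?C = "{0..<2 * pi}"
  define p where "p = \<Lambda> 1"
  define F where "F i \<theta> = coeff p i * cis (of_int (int i - int k) * \<theta>)" for i \<theta>
  define G where "G j \<theta> = b j * (indicator {\<alpha> j..\<beta> j} \<theta> *\<^sub>R cis (of_int (- int k) * \<theta>))" for j \<theta>
  have split: "type_I_form (r + 1) (arc_weights \<alpha> \<beta>) \<Lambda> (cis \<theta>) * cnj (cis \<theta> ^ k)
      = (\<Sum>i\<le>degree p. F i \<theta>) + (\<Sum>j=1..r. G j \<theta>)" if "\<theta> \<in> ?C" for \<theta>
  proof -
    have cnj: "cnj (cis \<theta> ^ k) = cis (of_int (- int k) * \<theta>)"
      by (simp add: Complex.DeMoivre cis_cnj del: complex_cnj_power)
    have "poly p (cis \<theta>) * cnj (cis \<theta> ^ k) = (\<Sum>i\<le>degree p. F i \<theta>)"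
      unfolding cnj poly_altdef sum_distrib_right F_def
      by (intro sum.cong refl) (simp add: Complex.DeMoivre cis_mult algebra_simps)
    moreover have "(\<Sum>j=1..r. b j * indicator {\<alpha> j..\<beta> j} \<theta>) * cnj (cis \<theta> ^ k) = (\<Sum>j=1..r. G j \<theta>)"
      unfolding cnj sum_distrib_right G_def
      by (intro sum.cong refl) (auto simp: indicator_def)
    ultimately show ?thesis
      using that unfolding type_I_form_arc_weights[OF b] by (simp add: Arg2pi_cis p_def distrib_right)
  qed
  have intF: "set_integrable lborel ?C (F i)" for i
    unfolding F_def by (intro set_integrable_mult_right set_integral_cis_circle(1))
  have F: "(LINT \<theta>:?C|lborel. F i \<theta>) = (if i = k then of_real (2 * pi) * coeff p k else 0)" for i
    unfolding F_def by (simp only: set_integral_mult_right set_integral_cis_circle(2)) auto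
  \<comment> \<open>Each arc lies inside the parameter interval of the circle, so its own indicator
    absorbs the outer one.\<close>
  have *: "indicator ?C \<theta> *\<^sub>R G j \<theta> = indicator {\<alpha> j..\<beta> j} \<theta> *\<^sub>R (b j * cis (of_int (- int k) * \<theta>))"
    if "j \<in> {1..r}" for j \<theta>
  proof -
    have "{\<alpha> j..\<beta> j} \<subseteq> ?C"
      using sub that by blast
    then show ?thesis
      by (auto simp: G_def indicator_def)
  qed
  have intG: "set_integrable lborel ?C (G j)" if "j \<in> {1..r}" for j
    using set_integrable_mult_right[OF set_integrable_cis[of "\<alpha> j" "\<beta> j" "of_int (- int k)"], of "b j"]
    by (simp only: set_integrable_def *[OF that])
  have G: "(LINT \<theta>:?C|lborel. G j \<theta>)
      = of_real (2 * pi) * (b j * of_real (arc_fourier \<Delta> (int k)) / arc_mid \<alpha> \<beta> j ^ k)"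
    if j: "j \<in> {1..r}" for j
  proof -
    have ab: "\<beta> j - \<alpha> j = \<Delta>" "\<alpha> j \<le> \<beta> j"
      using len \<open>0 < \<Delta>\<close> j by (auto, smt (verit) atLeastAtMost_iff)
    have "(LINT \<theta>:?C|lborel. G j \<theta>)
      = (LINT \<theta>:{\<alpha> j..\<beta> j}|lborel. b j * cis (of_int (- int k) * \<theta>))"
      by (simp only: set_lebesgue_integral_def *[OF j])
    also have "\<dots> = b j * (of_real (2 * pi * arc_fourier \<Delta> (int k))
        * cis (of_int (- int k) * ((\<alpha> j + \<beta> j) / 2)))"
      by (simp only: set_integral_mult_right set_integral_cis[OF ab(2)] ab(1) arc_fourier_minus)
    also have "cis (of_int (- int k) * ((\<alpha> j + \<beta> j) / 2)) = inverse (arc_mid \<alpha> \<beta> j ^ k)"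
      by (simp add: arc_mid_def Complex.DeMoivre cis_inverse)
    finally show ?thesis
      by (simp add: field_simps)
  qed
  have "(LINT \<theta>:?C|lborel. type_I_form (r + 1) (arc_weights \<alpha> \<beta>) \<Lambda> (cis \<theta>) * cnj (cis \<theta> ^ k))
    = (LINT \<theta>:?C|lborel. (\<Sum>i\<le>degree p. F i \<theta>) + (\<Sum>j=1..r. G j \<theta>))"
    by (intro set_lebesgue_integral_cong allI impI split) simp_all
  also have "\<dots> = (\<Sum>i\<le>degree p. LINT \<theta>:?C|lborel. F i \<theta>) + (\<Sum>j=1..r. LINT \<theta>:?C|lborel. G j \<theta>)"
    using intF intG
    unfolding set_integrable_def set_lebesgue_integral_def scaleR_add_right scaleR_sum_right
    by (simp only: Bochner_Integration.integral_add Bochner_Integration.integral_sum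
        Bochner_Integration.integrable_sum)
  \<comment> \<open>If k exceeds the degree, no index of the sum equals k, and
    \<open>coeff p k\<close> is 0 as well.\<close>
  also have "(\<Sum>i\<le>degree p. LINT \<theta>:?C|lborel. F i \<theta>) = of_real (2 * pi) * coeff p k"
    by (simp add: F coeff_eq_0)
  also have "(\<Sum>j=1..r. LINT \<theta>:?C|lborel. G j \<theta>) = of_real (2 * pi)
      * (\<Sum>j=1..r. b j * of_real (arc_fourier \<Delta> (int k)) / arc_mid \<alpha> \<beta> j ^ k)"
    by (simp only: G sum_distrib_left cong: sum.cong)
  finally show ?thesis
    by (simp add: circle_mean_def p_def distrib_left [symmetric] del: of_real_mult)
qed

section \<open>The nodes and the explicit type I vector\<close>

lemma sum_arc_index: "r < n \<Longrightarrow> (\<Sum>j=1..r + 1. arc_index n r j) = n"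
  by (simp only: sum_Suc_shift) (simp add: arc_index_def)

text \<open>Each midpoint lies in its own arc, and a point of the circle determines its angle in [0,
  2 pi). Equal midpoints would therefore give two disjoint arcs a common angle.\<close>

lemma inj_on_arc_mid:
  assumes sub: "\<forall>j\<in>A. {\<alpha> j..\<beta> j} \<subseteq> {0..<2 * pi}"
    and disj: "disjoint_family_on (\<lambda>j. {\<alpha> j..\<beta> j}) A"
    and le: "\<forall>j\<in>A. \<alpha> j \<le> \<beta> j"
  shows "inj_on (arc_mid \<alpha> \<beta>) A"
proof (rule inj_onI, rule ccontr)
  fix i j assume ij: "i \<in> A" "j \<in> A" "arc_mid \<alpha> \<beta> i = arc_mid \<alpha> \<beta> j" "i \<noteq> j"
  have mem: "(\<alpha> k + \<beta> k) / 2 \<in> {\<alpha> k..\<beta> k}" if "k \<in> A" for k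
    using le that by auto
  then have "Arg2pi (arc_mid \<alpha> \<beta> k) = (\<alpha> k + \<beta> k) / 2" if "k \<in> A" for k
    unfolding arc_mid_def using sub that by (intro Arg2pi_cis) fastforce+
  with ij have "(\<alpha> i + \<beta> i) / 2 = (\<alpha> j + \<beta> j) / 2"
    by metis
  with mem ij have "(\<alpha> i + \<beta> i) / 2 \<in> {\<alpha> i..\<beta> i} \<inter> {\<alpha> j..\<beta> j}"
    by (metis IntI)
  with disj ij show False
    by (auto simp: disjoint_family_on_def)
qed

theorem corollary3p9:
  fixes r n :: nat and \<alpha> \<beta> :: "nat \<Rightarrow> real" and \<Delta> :: real
    and x c :: "nat \<Rightarrow> complex" and a :: "int \<Rightarrow> real" and \<Lambda> :: "nat \<Rightarrow> complex poly"
  assumes "1 \<le> r" and "r < n"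
    and "\<forall>j\<in>{1..r}. {\<alpha> j..\<beta> j} \<subseteq> {0..<2 * pi}"
    and "disjoint_family_on (\<lambda>j. {\<alpha> j..\<beta> j}) {1..r}"
    and "\<forall>j\<in>{1..r}. \<beta> j - \<alpha> j = \<Delta>" and "0 < \<Delta>"
    and "\<exists>!\<Lambda>'. type_I_vector (r + 1) (arc_weights \<alpha> \<beta>) (arc_index n r) \<Lambda>'"
    and "type_I_vector (r + 1) (arc_weights \<alpha> \<beta>) (arc_index n r) \<Lambda>"
    and "x = arc_mid \<alpha> \<beta>" and "a = arc_fourier \<Delta>"
    and "\<forall>j\<in>{1..r}. c j = (-1) ^ (r - 1) * x j ^ (n - 2) / of_real (a (int (n - 1)))
           * ((\<Prod>m=1..r. x m) / (\<Prod>m\<in>{1..r} - {j}. x j - x m))"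
  shows "\<forall>z. norm z = 1 \<longrightarrow>
    type_I_form (r + 1) (arc_weights \<alpha> \<beta>) \<Lambda> z =
      (\<Sum>j=1..r. c j * indicator {\<alpha> j..\<beta> j} (Arg2pi z))
      - (\<Sum>l=0..n - r - 1. (\<Sum>k=1..r. c k * of_real (a (int l)) / x k ^ l) * z ^ l)"
proof -
  note sub = assms(3) and len = assms(5) and vec = assms(8) and c = assms(11)
  let ?\<omega> = "arc_weights \<alpha> \<beta>"
  have le: "\<forall>j\<in>{1..r}. \<alpha> j \<le> \<beta> j"
    using len \<open>0 < \<Delta>\<close> by (metis diff_gt_0_iff_gt less_imp_le)
  have inj: "inj_on x {1..r}"
    unfolding \<open>x = arc_mid \<alpha> \<beta>\<close> by (rule inj_on_arc_mid[OF sub assms(4) le])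
  have x0: "x j \<noteq> 0" for j
    by (simp add: \<open>x = arc_mid \<alpha> \<beta>\<close> arc_mid_def)
  have moment: "circle_mean (\<lambda>z. type_I_form (r + 1) ?\<omega> L z * cnj (z ^ k))
      = coeff (L 1) k + (\<Sum>j=1..r. b j * of_real (a (int k)) / x j ^ k)"
    if "\<forall>j\<in>{1..r}. L (Suc j) = [:b j:]" for L b k
    using circle_mean_type_I_form_arc_weights[OF that sub len \<open>0 < \<Delta>\<close>]
    by (simp add: \<open>x = arc_mid \<alpha> \<beta>\<close> \<open>a = arc_fourier \<Delta>\<close>)

  \<comment> \<open>Were this value zero, the convention for division by zero would make every c_j
    vanish.\<close>
  have a_nz: "a (int (n - 1)) \<noteq> 0"
  proof
    assume a0: "a (int (n - 1)) = 0"
    have deg: "\<forall>j\<in>{1..r + 1}. \<Lambda> j = 0 \<or> degree (\<Lambda> j) < arc_index n r j"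
      and one: "circle_mean (\<lambda>z. type_I_form (r + 1) ?\<omega> \<Lambda> z * cnj (z ^ (n - 1))) = 1"
      using vec unfolding type_I_vector_def Let_def sum_arc_index[OF \<open>r < n\<close>] by blast+
    have "\<Lambda> (Suc j) = [:coeff (\<Lambda> (Suc j)) 0:]" if "j \<in> {1..r}" for j
      using deg[rule_format, of "Suc j"] that
      by (auto simp: arc_index_def elim: degree_eq_zeroE)
    then have "1 = coeff (\<Lambda> 1) (n - 1)"
      using one moment[of \<Lambda> "\<lambda>j. coeff (\<Lambda> (Suc j)) 0" "n - 1"] a0 by simp
    moreover have "coeff (\<Lambda> 1) (n - 1) = 0"
      \<comment> \<open>The degree of \<open>\<Lambda> 1\<close> is below n - r, hence below n - 1
        because r is at least 1.\<close>
      using deg[rule_format, of 1] \<open>1 \<le> r\<close> by (auto simp: arc_index_def intro: coeff_eq_0)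
    ultimately show False
      by simp
  qed

  have c_sum: "(\<Sum>j=1..r. c j * of_real (a (int k)) / x j ^ k) = (if k = n - 1 then 1 else 0)"
    if k: "n - r \<le> k" "k < n" for k
  proof -
    define e where "e = n - 1 - k"
    \<comment> \<open>As n is at least 2, \<open>Suc (n - 2)\<close> is n - 1. It is written as the
      exponent n - 2 in c_j plus one further factor x_j.\<close>
    have e: "e < r" "k + e = Suc (n - 2)"
      using k assms(1,2) by (auto simp: e_def)
    have "c j / x j ^ k = (x j ^ e * (\<Prod>m\<in>{1..r} - {j}. - x m / (x j - x m))) / of_real (a (int (n - 1)))"
      if j: "j \<in> {1..r}" for j
    proof -
      \<comment> \<open>The sign in c_j collects the r - 1 minus signs of the Lagrange basis
        polynomial at 0.\<close>
      have "(\<Prod>m\<in>{1..r} - {j}. - x m / (x j - x m))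
        = (- 1) ^ (r - 1) * (\<Prod>m\<in>{1..r} - {j}. x m) / (\<Prod>m\<in>{1..r} - {j}. x j - x m)"
        using j by (simp add: prod_dividef prod_uminus)
      \<comment> \<open>The full product in c_j supplies the further factor x_j.\<close>
      moreover have "(\<Prod>m=1..r. x m) = x j * (\<Prod>m\<in>{1..r} - {j}. x m)"
        using j by (simp add: prod.remove)
      moreover have "x j ^ (n - 2) * x j = x j ^ e * x j ^ k"
        using e(2) by (metis add.commute power_Suc2 power_add)
      then have "x j ^ (n - 2) * x j / x j ^ k = x j ^ e"
        using x0 by simp
      ultimately show ?thesis
        using c j by (simp add: mult_ac flip: \<open>x j ^ (n - 2) * x j / x j ^ k = x j ^ e\<close>)
    qed
    then have "(\<Sum>j=1..r. c j * of_real (a (int k)) / x j ^ k)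
      = of_real (a (int k)) / of_real (a (int (n - 1)))
        * (\<Sum>j=1..r. x j ^ e * (\<Prod>m\<in>{1..r} - {j}. - x m / (x j - x m)))"
      unfolding sum_distrib_left
      by (intro sum.cong refl) (metis (no_types, lifting) mult.commute times_divide_eq_left times_divide_eq_right)
    also have "\<dots> = of_real (a (int k)) / of_real (a (int (n - 1))) * 0 ^ e"
      using Lagrange_interpolation_power_at_0[OF _ inj, of e] e(1) by simp
    \<comment> \<open>The exponent e is 0 exactly for k = n - 1, and then the quotient of the two
      Fourier coefficients is 1.\<close>
    also have "\<dots> = (if k = n - 1 then 1 else 0)"
      using a_nz k by (auto simp: e_def power_0_left)
    finally show ?thesis .
  qed

  define s where "s l = (\<Sum>k=1..r. c k * of_real (a (int l)) / x k ^ l)" for l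
  \<comment> \<open>The polynomial part is chosen to cancel the arc contributions to the moments
    below n - r. The restriction provides the extensionality required of a type I vector.\<close>
  define M where "M = restrict (\<lambda>j. if j = 1 then - (\<Sum>l\<le>n - r - 1. monom (s l) l) else [:c (j - 1):]) {1..r + 1}"
  have M1: "M 1 = - (\<Sum>l\<le>n - r - 1. monom (s l) l)" and MSuc: "\<forall>j\<in>{1..r}. M (Suc j) = [:c j:]"
    by (auto simp: M_def)
  have coeff_M1: "coeff (M 1) k = (if k < n - r then - s k else 0)" for k
    using \<open>r < n\<close> unfolding M1 by (auto simp: coeff_sum)
  have M_moment: "circle_mean (\<lambda>z. type_I_form (r + 1) ?\<omega> M z * cnj (z ^ k)) = (if k = n - 1 then 1 else 0)"
    if "k < n" for k
    \<comment> \<open>Below n - r the two contributions cancel, and k differs from n - 1 since r is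
      at least 1. From n - r on, the polynomial part contributes nothing and \<open>c_sum\<close>
      applies.\<close>
    using c_sum[of k] that assms(1,2) unfolding moment[OF MSuc] coeff_M1 s_def by auto
  have "type_I_vector (r + 1) ?\<omega> (arc_index n r) M"
    unfolding type_I_vector_def Let_def sum_arc_index[OF \<open>r < n\<close>]
  proof (intro conjI)
    show "M \<in> extensional {1..r + 1}"
      by (simp add: M_def)
    \<comment> \<open>A zero vector would have a zero form, against its moment of order n - 1 being
      1.\<close>
    show "\<exists>j\<in>{1..r + 1}. M j \<noteq> 0"
    proof (rule ccontr)
      assume "\<not> ?thesis"
      then have "type_I_form (r + 1) ?\<omega> M z = 0" for z
        by (simp add: type_I_form_def)
      with M_moment[of "n - 1"] \<open>r < n\<close> show False
        by (simp add: circle_mean_def)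
    qed
    show "\<forall>j\<in>{1..r + 1}. M j = 0 \<or> degree (M j) < arc_index n r j"
    proof
      fix j assume j: "j \<in> {1..r + 1}"
      have "degree (M 1) \<le> n - r - 1"
        by (rule degree_le) (use coeff_M1 in auto)
      with j \<open>r < n\<close> show "M j = 0 \<or> degree (M j) < arc_index n r j"
        by (cases "j = 1") (auto simp: arc_index_def M_def)
    qed
  qed (use M_moment \<open>r < n\<close> in auto)
  with assms(7) vec have "\<Lambda> = M"
    by blast
  then show ?thesis
    by (auto simp: type_I_form_arc_weights[OF MSuc] M1 poly_sum poly_monom s_def atLeast0AtMost
        simp del: One_nat_def)
qed

end
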